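(* Suppose $k=k(n)$ is a positive integer with $1\ll k\ll\log n$. Then, for any $\omega=\omega(n)\gg1$ and any (real) constant $\alpha$, as $n\to\infty$, $$\mathbb{P}\big[\mathrm{comp}_{\max}(\mathbf{C}_{n,p})\ge k\big]\to\begin{cases}0,&\text{if } p=e^{-(\log n+\omega)/k},\\ 1-e^{-e^{\alpha}},&\text{if } p=e^{-(\log n-\alpha)/k},\\ 1,&\text{if } p=e^{-(\log n-\omega)/k},\end{cases}$$ and $$\mathbb{P}\big[\mathrm{gap}_{\max}(\mathbf{C}_{n,p})\ge k\big]\to\begin{cases}1,&\text{if } q=e^{-(\log n-\omega)/k},\\ 1-e^{-e^{\alpha}},&\text{if } q=e^{-(\log n-\alpha)/k},\\ 0,&\text{if } q=e^{-(\log n+\omega)/k}.\end{cases}$$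
   Context: An $n$-composition is a sequence of $n$ nonnegative integers. For $p=p(n)\in[0,1)$ and $q=1-p$, the geometric random composition $\mathbf{C}_{n,p}$ is the random $n$-composition whose terms are independent, with $\mathbb{P}[\mathbf{C}_{n,p}(i)=j]=qp^j$ for every $j\ge0$ and $i\in\{1,\dots,n\}$. (Thus $\omega$ is understood to be such that the displayed expression for $p$ or $q$ is a legitimate value, $p\in[0,1)$.) A component of a composition is a maximal run of consecutive nonzero terms; a gap is a maximal run of consecutive zero terms. $\mathrm{comp}_{\max}(C)$ and $\mathrm{gap}_{\max}(C)$ denote the length of the longest component of $C$ and of the longest gap in $C$ (taken to be $0$ if there is none). For positive functions of $n$: $f\ll g$ (or $g\gg f$) means $\lim_{n\to\infty} f/g=0$; in particular $\omega\gg1$ means $\omega\to\infty$. *)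

theory Defs
  imports "HOL-Probability.Probability"
begin

(* An n-composition is a function C :: nat => nat, of which only the values C 1, ..., C n matter. *)

definition is_run :: "nat \<Rightarrow> (nat \<Rightarrow> bool) \<Rightarrow> nat set \<Rightarrow> bool" where
  "is_run n P S \<longleftrightarrow> (\<exists>a b. 1 \<le> a \<and> a \<le> b \<and> b \<le> n \<and> S = {a..b}) \<and> (\<forall>i\<in>S. P i)"

definition maximal_run :: "nat \<Rightarrow> (nat \<Rightarrow> bool) \<Rightarrow> nat set \<Rightarrow> bool" where
  "maximal_run n P S \<longleftrightarrow> is_run n P S \<and> (\<forall>T. is_run n P T \<and> S \<subseteq> T \<longrightarrow> T = S)"

definition components :: "nat \<Rightarrow> (nat \<Rightarrow> nat) \<Rightarrow> nat set set" where
  "components n C = {S. maximal_run n (\<lambda>i. C i \<noteq> 0) S}"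

definition gaps :: "nat \<Rightarrow> (nat \<Rightarrow> nat) \<Rightarrow> nat set set" where
  "gaps n C = {S. maximal_run n (\<lambda>i. C i = 0) S}"

(* The inserted 0 is the value when there is no component (gap); all lengths are positive. *)

definition comp_max :: "nat \<Rightarrow> (nat \<Rightarrow> nat) \<Rightarrow> nat" where
  "comp_max n C = Max (insert 0 (card ` components n C))"

definition gap_max :: "nat \<Rightarrow> (nat \<Rightarrow> nat) \<Rightarrow> nat" where
  "gap_max n C = Max (insert 0 (card ` gaps n C))"

(* The parameter of geometric_pmf is the success probability q = 1 - p, so that each term takes
   the value j with probability p ^ j * q when 0 <= p < 1. Outside {1..n} the value is 0. *)

definition geometric_composition :: "nat \<Rightarrow> real \<Rightarrow> (nat \<Rightarrow> nat) pmf" where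
  "geometric_composition n p = Pi_pmf {1..n} 0 (\<lambda>_. geometric_pmf (1 - p))"

end

theory Submission
  imports Defs "HOL-Real_Asymp.Real_Asymp"
begin

text \<open>
  Both statements concern the longest run of successes in \<open>n\<close> independent trials with success
  probability \<open>s\<close>: a success is a nonzero term for components (\<open>s = p\<close>) and a zero term for gaps
  (\<open>s = q\<close>). Let \<open>u n\<close>, formally \<open>no_run_prob n\<close>, be the probability that no \<open>k\<close> consecutive trials
  succeed. Splitting according to the trial at which a run of length \<open>k\<close> is first completed gives
  the exact recursion
  \<open>u (n + 1) = u n - (1 - s) s^k u (n - k)\<close>. Two elementary comparisons of \<open>u (n - k)\<close> with \<open>u n\<close>, namely
  \<open>u n \<le> u (n - k)\<close> and \<open>(1 - s) u (n - k) \<le> u n\<close> (a failure at trial \<open>n - k + 1\<close> leaves no room for a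
  run afterwards), turn it into geometric bounds:
  \<open>(1 - s^k)^n \<le> u n \<le> (1 - (1 - s) s^k)^(n - k)\<close>.

  If \<open>s = exp (- (ln n + w) / k)\<close>, then \<open>n s^k = exp (- w)\<close>. For constant \<open>w = - \<alpha>\<close> the condition
  \<open>k \<lless> ln n\<close> forces both \<open>s \<rightarrow> 0\<close> and \<open>k / n \<rightarrow> 0\<close>, while \<open>1 \<lless> k\<close> makes \<open>\<alpha> / k\<close> negligible, so the two
  bounds have the same limit \<open>exp (- exp \<alpha>)\<close>. For
  \<open>w \<rightarrow> \<infinity>\<close> the lower bound on \<open>u n\<close> tends to \<open>1\<close>. For \<open>w \<rightarrow> - \<infinity>\<close> the upper bound tends to \<open>0\<close> as
  long as the factor \<open>1 - s\<close> stays away from \<open>0\<close>, but \<open>s\<close> may then be close to \<open>1\<close>. In that regime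
  disjoint blocks of length \<open>k\<close> give \<open>u n \<le> (1 - s^k)^(n div k)\<close>, which is small because
  \<open>2^(- k) n / k\<close> grows faster than any power of \<open>n\<close> below the first.
\<close>

section \<open>Runs of successes in independent trials\<close>

lemma measure_pair_pmf_Times:
  "measure_pmf.prob (pair_pmf M N) (A \<times> B) = measure_pmf.prob M A * measure_pmf.prob N B"
proof -
  have "measure_pmf.prob (pair_pmf M N) (A \<times> B) =
      measure_pmf.prob (pair_pmf M N) ((A \<times> B) \<inter> set_pmf (pair_pmf M N))"
    by (rule measure_Int_set_pmf[symmetric])
  also have "(A \<times> B) \<inter> set_pmf (pair_pmf M N) = (A \<inter> set_pmf M) \<times> (B \<inter> set_pmf N)"
    by auto
  finally show ?thesis
    by (simp add: measure_pmf_prob_product measure_Int_set_pmf)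
qed

text \<open>
  The single independence fact that is needed: an event on the first \<open>m\<close> coordinates, followed by
  prescribed sets for the individual coordinates beyond \<open>m\<close>. Taking \<open>UNIV\<close> for the latter
  forgets coordinates.
\<close>

lemma prob_prefix_and_block:
  fixes M :: "'a pmf" and B :: "nat \<Rightarrow> 'a set"
  assumes "m \<le> N"
    and X: "\<And>C C'. (\<And>i. 1 \<le> i \<Longrightarrow> i \<le> m \<Longrightarrow> C i = C' i) \<Longrightarrow> X C = X C'"
  shows "measure_pmf.prob (Pi_pmf {1..N} d (\<lambda>_. M)) {C. X C \<and> (\<forall>i\<in>{m<..N}. C i \<in> B i)} =
    measure_pmf.prob (Pi_pmf {1..m} d (\<lambda>_. M)) {C. X C} * (\<Prod>i\<in>{m<..N}. measure_pmf.prob M (B i))"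
proof -
  let ?h = "\<lambda>(f, g) x. if x \<in> {1..m} then f x else g x"
  have split: "{1..N} = {1..m} \<union> {m<..N}" using \<open>m \<le> N\<close> by auto
  have vimage: "?h -` {C. X C \<and> (\<forall>i\<in>{m<..N}. C i \<in> B i)} = {C. X C} \<times> Pi {m<..N} B"
  proof -
    have "X (?h (f, g)) = X f" for f g by (rule X) auto
    then show ?thesis by auto
  qed
  have "measure_pmf.prob (Pi_pmf {1..N} d (\<lambda>_. M)) {C. X C \<and> (\<forall>i\<in>{m<..N}. C i \<in> B i)} =
      measure_pmf.prob (pair_pmf (Pi_pmf {1..m} d (\<lambda>_. M)) (Pi_pmf {m<..N} d (\<lambda>_. M)))
        ({C. X C} \<times> Pi {m<..N} B)"
    unfolding split by (subst Pi_pmf_union) (simp_all only: measure_map_pmf vimage finite_atLeastAtMost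
        finite_greaterThanAtMost, auto)
  also have "\<dots> = measure_pmf.prob (Pi_pmf {1..m} d (\<lambda>_. M)) {C. X C} *
      measure_pmf.prob (Pi_pmf {m<..N} d (\<lambda>_. M)) (Pi {m<..N} B)"
    by (rule measure_pair_pmf_Times)
  also have "measure_pmf.prob (Pi_pmf {m<..N} d (\<lambda>_. M)) (Pi {m<..N} B) =
      (\<Prod>i\<in>{m<..N}. measure_pmf.prob M (B i))"
    by (rule measure_Pi_pmf_Pi) simp
  finally show ?thesis .
qed

locale iid_trials =
  fixes d :: 'a and M :: "'a pmf" and Q :: "'a \<Rightarrow> bool" and k :: nat
  assumes k_pos: "0 < k"
begin

definition success_prob :: real where "success_prob = measure_pmf.prob M {x. Q x}"

definition has_run :: "nat \<Rightarrow> (nat \<Rightarrow> 'a) \<Rightarrow> bool" where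
  "has_run n C \<longleftrightarrow> (\<exists>j. j + k \<le> n \<and> (\<forall>i\<in>{j<..j + k}. Q (C i)))"

definition no_run_prob :: "nat \<Rightarrow> real" where
  "no_run_prob n = measure_pmf.prob (Pi_pmf {1..n} d (\<lambda>_. M)) {C. \<not> has_run n C}"

lemma success_prob_range: "0 \<le> success_prob" "success_prob \<le> 1"
  by (auto simp: success_prob_def)

lemma success_prob_power_range: "0 \<le> success_prob ^ k" "success_prob ^ k \<le> 1"
  "0 \<le> (1 - success_prob) * success_prob ^ k" "(1 - success_prob) * success_prob ^ k \<le> 1"
  using success_prob_range by (auto intro: power_le_one mult_le_one)

lemma prob_failure: "measure_pmf.prob M {x. \<not> Q x} = 1 - success_prob"
proof -
  have "{x. \<not> Q x} = space (measure_pmf M) - {x. Q x}" by auto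
  then show ?thesis
    unfolding success_prob_def by (simp only: measure_pmf.prob_compl sets_measure_pmf UNIV_I)
qed

lemma no_run_prob_range: "0 \<le> no_run_prob n" "no_run_prob n \<le> 1"
  by (auto simp: no_run_prob_def)

lemma has_run_mono: "has_run m C \<Longrightarrow> m \<le> n \<Longrightarrow> has_run n C"
  unfolding has_run_def by (meson order_trans)

lemma has_run_cong: "(\<And>i. 1 \<le> i \<Longrightarrow> i \<le> n \<Longrightarrow> C i = C' i) \<Longrightarrow> has_run n C = has_run n C'"
  unfolding has_run_def by (intro ex_cong1 conj_cong refl ball_cong) auto

text \<open>
  A failure at position \<open>m + 1\<close> confines a run to the positions up to \<open>m\<close> when at most \<open>k - 1\<close>
  positions follow the failure.
\<close>

lemma has_run_before_failure:
  assumes "\<not> Q (C (Suc m))" "n \<le> m + k" "has_run n C"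
  shows "has_run m C"
proof -
  obtain j where j: "j + k \<le> n" "\<forall>i\<in>{j<..j + k}. Q (C i)"
    using assms(3) by (auto simp: has_run_def)
  then have "Suc m \<notin> {j<..j + k}" using assms(1) by blast
  then have "j + k \<le> m" using j assms(2) by auto
  then show ?thesis using j unfolding has_run_def by blast
qed

lemma prob_no_run_and_block:
  assumes "m \<le> N"
  shows "measure_pmf.prob (Pi_pmf {1..N} d (\<lambda>_. M))
      {C. \<not> has_run m C \<and> (\<forall>i\<in>{m<..N}. C i \<in> B i)} =
    no_run_prob m * (\<Prod>i\<in>{m<..N}. measure_pmf.prob M (B i))"
  unfolding no_run_prob_def using assms by (rule prob_prefix_and_block) (simp cong: has_run_cong)

lemma no_run_prob_as_prefix:
  assumes "m \<le> N"
  shows "measure_pmf.prob (Pi_pmf {1..N} d (\<lambda>_. M)) {C. \<not> has_run m C} = no_run_prob m"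
  using prob_no_run_and_block[OF assms, of "\<lambda>_. UNIV"] by simp

lemma no_run_prob_short: "n < k \<Longrightarrow> no_run_prob n = 1"
  by (simp add: no_run_prob_def has_run_def)

lemma no_run_prob_antimono:
  assumes "m \<le> n"
  shows "no_run_prob n \<le> no_run_prob m"
proof -
  have "no_run_prob n \<le> measure_pmf.prob (Pi_pmf {1..n} d (\<lambda>_. M)) {C. \<not> has_run m C}"
    unfolding no_run_prob_def using assms
    by (intro measure_pmf.finite_measure_mono) (auto dest: has_run_mono)
  then show ?thesis using no_run_prob_as_prefix[OF assms] by simp
qed

text \<open>The window \<open>n + 1, \<dots>, n + k\<close> is independent of the first \<open>n\<close> trials; ignoring the windows that
  straddle trial \<open>n\<close> turns the equality into an inequality.\<close>

lemma no_run_prob_block: "no_run_prob (n + k) \<le> (1 - success_prob ^ k) * no_run_prob n"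
proof -
  let ?P = "measure_pmf.prob (Pi_pmf {1..n + k} d (\<lambda>_. M))"
  let ?A = "{C. \<not> has_run n C}"
  let ?B = "{C. \<not> has_run n C \<and> (\<forall>i\<in>{n<..n + k}. C i \<in> {x. Q x})}"
  have "no_run_prob (n + k) \<le> ?P (?A - ?B)"
    unfolding no_run_prob_def by (intro measure_pmf.finite_measure_mono) (auto simp: has_run_def)
  also have "\<dots> = ?P ?A - ?P ?B"
    by (rule measure_pmf.finite_measure_Diff) auto
  also have "\<dots> = no_run_prob n - no_run_prob n * success_prob ^ k"
    by (subst prob_no_run_and_block) (simp_all add: no_run_prob_as_prefix[simplified] success_prob_def)
  finally show ?thesis by (simp add: algebra_simps)
qed

text \<open>
  If the first run is completed at trial \<open>n + 1\<close>, then trials \<open>n - k + 2, \<dots>, n + 1\<close> are successes and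
  trial \<open>n - k + 1\<close> is a failure, since otherwise a run would have been completed at \<open>n\<close>.
  The absence of runs up to \<open>n - k\<close> is independent of these \<open>k + 1\<close> trials.
\<close>

lemma no_run_prob_step:
  assumes "k \<le> n"
  shows "no_run_prob (Suc n) =
    no_run_prob n - (1 - success_prob) * success_prob ^ k * no_run_prob (n - k)"
proof -
  let ?P = "measure_pmf.prob (Pi_pmf {1..Suc n} d (\<lambda>_. M))"
  let ?A = "{C. \<not> has_run n C}"
  define f where "f = Suc (n - k)"
  define B where "B = (\<lambda>i. if i = f then {x. \<not> Q x} else {x. Q x})"
  let ?B = "{C. \<not> has_run (n - k) C \<and> (\<forall>i\<in>{n - k<..Suc n}. C i \<in> B i)}"
  have I: "{n - k<..Suc n} = insert f {f<..Suc n}" "f + k = Suc n"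
    using assms by (auto simp: f_def)
  have new_run: "{C. \<not> has_run (Suc n) C} = ?A - ?B"
  proof (intro set_eqI iffI)
    fix C assume "C \<in> {C. \<not> has_run (Suc n) C}"
    moreover have "has_run (Suc n) C" if "C \<in> ?B"
      unfolding has_run_def
      by (rule exI[of _ f]) (use that I in \<open>auto simp: B_def split: if_splits\<close>)
    ultimately show "C \<in> ?A - ?B" using has_run_mono[of n C "Suc n"] by auto
  next
    fix C assume C: "C \<in> ?A - ?B"
    have False if run: "has_run (Suc n) C"
    proof -
      have no: "\<not> has_run n C" and no': "\<not> has_run (n - k) C"
        using C has_run_mono[of "n - k" C n] by auto
      obtain j where j: "j + k \<le> Suc n" "\<forall>i\<in>{j<..j + k}. Q (C i)"
        using run by (auto simp: has_run_def)
      then have "j + k = Suc n"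
        using no unfolding has_run_def by (metis le_SucE)
      then have jf: "j = f" using I by simp
      have "\<not> Q (C f)"
      proof
        assume f: "Q (C f)"
        have "\<forall>i\<in>{n - k<..(n - k) + k}. Q (C i)"
        proof
          fix i assume "i \<in> {n - k<..n - k + k}"
          then show "Q (C i)" using j(2) f assms unfolding jf f_def
            by (cases "i = Suc (n - k)") auto
        qed
        with no assms show False unfolding has_run_def by (metis le_add_diff_inverse2 le_refl)
      qed
      then have "C \<in> ?B" using j(2) no' I jf by (auto simp: B_def)
      with C show False by simp
    qed
    then show "C \<in> {C. \<not> has_run (Suc n) C}" by blast
  qed
  have sub: "?B \<subseteq> ?A"
  proof
    fix C assume C: "C \<in> ?B"
    have "\<not> Q (C (Suc (n - k)))" using C I by (auto simp: B_def f_def)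
    with C have "\<not> has_run n C" using has_run_before_failure[of C "n - k" n] assms by auto
    then show "C \<in> ?A" by simp
  qed
  have "(\<Prod>i\<in>{n - k<..Suc n}. measure_pmf.prob M (B i)) =
      (1 - success_prob) * (\<Prod>i\<in>{f<..Suc n}. measure_pmf.prob M {x. Q x})"
    unfolding I by (subst prod.insert) (auto simp: B_def prob_failure intro!: prod.cong)
  also have "\<dots> = (1 - success_prob) * success_prob ^ k"
    by (simp add: success_prob_def flip: I(2))
  finally have prod: "(\<Prod>i\<in>{n - k<..Suc n}. measure_pmf.prob M (B i)) =
      (1 - success_prob) * success_prob ^ k" .
  have "no_run_prob (Suc n) = ?P (?A - ?B)" unfolding no_run_prob_def new_run ..
  also have "\<dots> = ?P ?A - ?P ?B" by (rule measure_pmf.finite_measure_Diff) (use sub in auto)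
  also have "\<dots> = no_run_prob n - no_run_prob (n - k) * ((1 - success_prob) * success_prob ^ k)"
    by (subst prob_no_run_and_block) (simp_all add: no_run_prob_as_prefix[simplified] prod)
  finally show ?thesis by (simp add: algebra_simps)
qed

text \<open>Forcing a failure at trial \<open>n - k + 1\<close> separates the first \<open>n - k\<close> trials from the last \<open>k - 1\<close>,
  which are too few for a run.\<close>

lemma no_run_prob_ge_with_barrier:
  assumes "k \<le> n"
  shows "(1 - success_prob) * no_run_prob (n - k) \<le> no_run_prob n"
proof -
  define f where "f = Suc (n - k)"
  define B where "B = (\<lambda>i. if i = f then {x. \<not> Q x} else UNIV)"
  have f: "f \<in> {n - k<..n}" using assms k_pos by (auto simp: f_def)
  have "(\<Prod>i\<in>{n - k<..n}. measure_pmf.prob M (B i)) =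
      (\<Prod>i\<in>{n - k<..n}. if i = f then 1 - success_prob else 1)"
    by (rule prod.cong) (auto simp: B_def prob_failure)
  also have "\<dots> = 1 - success_prob" using f by simp
  finally have prod: "(\<Prod>i\<in>{n - k<..n}. measure_pmf.prob M (B i)) = 1 - success_prob" .
  have "no_run_prob (n - k) * (1 - success_prob) = measure_pmf.prob (Pi_pmf {1..n} d (\<lambda>_. M))
      {C. \<not> has_run (n - k) C \<and> (\<forall>i\<in>{n - k<..n}. C i \<in> B i)}"
    by (subst prob_no_run_and_block) (simp_all add: prod)
  also have "\<dots> \<le> no_run_prob n"
    unfolding no_run_prob_def
  proof (intro measure_pmf.finite_measure_mono subsetI)
    fix C assume C: "C \<in> {C. \<not> has_run (n - k) C \<and> (\<forall>i\<in>{n - k<..n}. C i \<in> B i)}"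
    have "\<not> Q (C f)" using C f by (metis (mono_tags, lifting) B_def mem_Collect_eq)
    with C have "\<not> has_run n C"
      using has_run_before_failure[of C "n - k" n] assms by (auto simp: f_def)
    then show "C \<in> {C. \<not> has_run n C}" by simp
  qed auto
  finally show ?thesis by (simp add: mult.commute)
qed

lemma no_run_prob_at_k: "no_run_prob k = 1 - success_prob ^ k"
proof -
  have eq: "has_run k C \<longleftrightarrow> (\<forall>i\<in>{0<..k}. C i \<in> {x. Q x})" for C
    by (auto simp: has_run_def)
  have "measure_pmf.prob (Pi_pmf {1..k} d (\<lambda>_. M)) {C. has_run k C} = success_prob ^ k"
    using prob_prefix_and_block[of 0 k "\<lambda>_. True" d M "\<lambda>_. {x. Q x}"] by (simp add: eq success_prob_def)
  moreover have "{C. \<not> has_run k C} = space (measure_pmf (Pi_pmf {1..k} d (\<lambda>_. M))) - {C. has_run k C}"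
    by auto
  ultimately show ?thesis
    unfolding no_run_prob_def by (simp only: measure_pmf.prob_compl sets_measure_pmf UNIV_I)
qed

text \<open>
  The barrier estimate absorbs the factor \<open>1 - s\<close> of the recursion, which leaves
  \<open>(1 - s^k) u n \<le> u (n + 1)\<close>: conditioning on the absence of earlier runs does not make a run ending
  at trial \<open>n + 1\<close> more likely. The first \<open>k\<close> steps lie outside the range of the recursion.
\<close>

lemma no_run_prob_lower_bound: "(1 - success_prob ^ k) ^ n \<le> no_run_prob n"
proof (induction n)
  case 0
  then show ?case using k_pos by (simp add: no_run_prob_short)
next
  case (Suc n)
  have "(1 - success_prob ^ k) * no_run_prob n \<le> no_run_prob (Suc n)"
  proof -
    consider "Suc n < k" | "Suc n = k" | "k \<le> n" by linarith
    then show ?thesis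
    proof cases
      case 1
      then show ?thesis using success_prob_power_range by (simp add: no_run_prob_short)
    next
      case 2
      then show ?thesis using no_run_prob_at_k no_run_prob_short[of n] by simp
    next
      case 3
      have "success_prob ^ k * ((1 - success_prob) * no_run_prob (n - k)) \<le>
          success_prob ^ k * no_run_prob n"
        using no_run_prob_ge_with_barrier[OF 3] success_prob_power_range by (intro mult_left_mono) auto
      then show ?thesis using no_run_prob_step[OF 3] by (simp add: algebra_simps)
    qed
  qed
  moreover have "(1 - success_prob ^ k) * (1 - success_prob ^ k) ^ n \<le>
      (1 - success_prob ^ k) * no_run_prob n"
    using Suc success_prob_power_range by (intro mult_left_mono) auto
  ultimately show ?case by simp
qed

text \<open>The loss from the recursion is at least \<open>(1 - s) s^k u n\<close> by monotonicity; truncated subtraction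
  makes the bound trivial for \<open>n < k\<close>.\<close>

lemma no_run_prob_upper_bound:
  "no_run_prob n \<le> (1 - (1 - success_prob) * success_prob ^ k) ^ (n - k)"
proof (cases "k \<le> n")
  case True
  have "no_run_prob (k + m) \<le> (1 - (1 - success_prob) * success_prob ^ k) ^ m" for m
  proof (induction m)
    case 0
    then show ?case using no_run_prob_range by simp
  next
    case (Suc m)
    have "(1 - success_prob) * success_prob ^ k * no_run_prob (k + m) \<le>
        (1 - success_prob) * success_prob ^ k * no_run_prob (k + m - k)"
      using success_prob_power_range by (intro mult_left_mono no_run_prob_antimono) auto
    then have "no_run_prob (k + Suc m) \<le>
        (1 - (1 - success_prob) * success_prob ^ k) * no_run_prob (k + m)"
      using no_run_prob_step[of "k + m"] by (simp add: algebra_simps)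
    also have "\<dots> \<le> (1 - (1 - success_prob) * success_prob ^ k) *
        (1 - (1 - success_prob) * success_prob ^ k) ^ m"
      using Suc success_prob_power_range by (intro mult_left_mono) auto
    finally show ?case by simp
  qed
  from this[of "n - k"] True show ?thesis by simp
qed (use no_run_prob_range in auto)

text \<open>Free of the factor \<open>1 - s\<close>, and so useful when \<open>s\<close> is close to \<open>1\<close>; the price is the division
  of the exponent by \<open>k\<close>.\<close>

lemma no_run_prob_upper_bound_blocks: "no_run_prob n \<le> (1 - success_prob ^ k) ^ (n div k)"
proof -
  have "no_run_prob (m * k) \<le> (1 - success_prob ^ k) ^ m" for m
  proof (induction m)
    case 0
    then show ?case using no_run_prob_range by simp
  next
    case (Suc m)
    have "no_run_prob (Suc m * k) \<le> (1 - success_prob ^ k) * no_run_prob (m * k)"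
      using no_run_prob_block[of "m * k"] by (simp add: add.commute)
    also have "\<dots> \<le> (1 - success_prob ^ k) * (1 - success_prob ^ k) ^ m"
      using Suc success_prob_power_range by (intro mult_left_mono) auto
    finally show ?case by simp
  qed
  then show ?thesis using no_run_prob_antimono[of "n div k * k" n]
    by (meson div_times_less_eq_dividend order_trans)
qed

lemma prob_has_run:
  "measure_pmf.prob (Pi_pmf {1..n} d (\<lambda>_. M)) {C. has_run n C} = 1 - no_run_prob n"
proof -
  have "{C. has_run n C} = space (measure_pmf (Pi_pmf {1..n} d (\<lambda>_. M))) - {C. \<not> has_run n C}"
    by auto
  then show ?thesis
    unfolding no_run_prob_def by (simp only: measure_pmf.prob_compl sets_measure_pmf UNIV_I)
qed

end

section \<open>Maximal runs and their lengths\<close>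

lemma ex_maximal_run_superset:
  assumes "is_run n P S"
  shows "\<exists>T. maximal_run n P T \<and> S \<subseteq> T"
proof -
  have "finite {T. is_run n P T}"
    by (rule finite_subset[of _ "Pow {1..n}"]) (auto simp: is_run_def)
  from finite_has_maximal2[OF this, of S] assms obtain T
    where "is_run n P T" "S \<subseteq> T" "\<forall>U. is_run n P U \<longrightarrow> T \<subseteq> U \<longrightarrow> T = U" by auto
  then show ?thesis unfolding maximal_run_def by metis
qed

text \<open>
  Every run extends to a maximal one, so the longest maximal run has length at least \<open>k\<close> as soon as
  some window of length \<open>k\<close> is filled. Positivity of \<open>k\<close> discards the value \<open>0\<close> that stands for the absence of runs.
\<close>

lemma longest_run_ge_iff:
  assumes "0 < k"
  shows "k \<le> Max (insert 0 (card ` {S. maximal_run n P S})) \<longleftrightarrow>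
    (\<exists>j. j + k \<le> n \<and> (\<forall>i\<in>{j<..j + k}. P i))" (is "?L \<longleftrightarrow> ?R")
proof -
  have fin: "finite {S. maximal_run n P S}"
    by (rule finite_subset[of _ "Pow {1..n}"]) (auto simp: is_run_def maximal_run_def)
  have "?L \<longleftrightarrow> (\<exists>S. maximal_run n P S \<and> k \<le> card S)"
    using assms fin by (subst Max_ge_iff) auto
  also have "\<dots> \<longleftrightarrow> ?R"
  proof
    assume "\<exists>S. maximal_run n P S \<and> k \<le> card S"
    then obtain S where "is_run n P S" "k \<le> card S" by (auto simp: maximal_run_def)
    then obtain a b where ab: "1 \<le> a" "a \<le> b" "b \<le> n" "\<forall>i\<in>{a..b}. P i" "k \<le> Suc b - a"
      unfolding is_run_def by auto
    have "\<forall>i\<in>{a - 1<..a - 1 + k}. P i" using ab by (intro ballI bspec[OF ab(4)]) auto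
    moreover have "a - 1 + k \<le> n" using ab by simp
    ultimately show ?R by blast
  next
    assume ?R
    then obtain j where j: "j + k \<le> n" "\<forall>i\<in>{j<..j + k}. P i" by blast
    then have "is_run n P {Suc j..j + k}" using assms
      unfolding is_run_def by (intro conjI exI[of _ "Suc j"] exI[of _ "j + k"]) auto
    then obtain T where T: "maximal_run n P T" "{Suc j..j + k} \<subseteq> T"
      using ex_maximal_run_superset by blast
    moreover have "finite T" using T(1) by (auto simp: maximal_run_def is_run_def)
    ultimately have "k \<le> card T" using card_mono[of T "{Suc j..j + k}"] by simp
    then show "\<exists>S. maximal_run n P S \<and> k \<le> card S" using T by blast
  qed
  finally show ?thesis .
qed

section \<open>Limits of the run probability\<close>

lemma one_minus_power_le_exp:
  fixes x :: real
  assumes "x \<le> 1"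
  shows "(1 - x) ^ n \<le> exp (- x * real n)"
proof -
  have "(1 - x) ^ n \<le> exp (- x) ^ n"
    using assms exp_ge_add_one_self[of "- x"] by (intro power_mono) auto
  then show ?thesis by (simp add: mult.commute flip: exp_of_nat_mult)
qed

text \<open>
  The asymptotic analysis uses only the three bounds on the run probability \<open>R\<close> and the
  growth of \<open>k\<close>, so it applies verbatim to components and to gaps.
\<close>

locale run_probability_sequence =
  fixes k :: "nat \<Rightarrow> nat" and s R :: "nat \<Rightarrow> real"
  assumes k_pos: "n \<ge> 1 \<Longrightarrow> 0 < k n"
    and k_large: "filterlim k at_top sequentially"
    and k_small: "(\<lambda>n. real (k n) / ln (real n)) \<longlonglongrightarrow> 0"
    and s_range: "0 \<le> s n" "s n \<le> 1"
    and R_le: "n \<ge> 1 \<Longrightarrow> R n \<le> 1 - (1 - s n ^ k n) ^ n"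
    and R_ge: "n \<ge> 1 \<Longrightarrow> 1 - (1 - (1 - s n) * s n ^ k n) ^ (n - k n) \<le> R n"
    and R_ge_blocks: "n \<ge> 1 \<Longrightarrow> 1 - (1 - s n ^ k n) ^ (n div k n) \<le> R n"
    and R_range: "0 \<le> R n" "R n \<le> 1"
begin

lemma s_power_range: "0 \<le> s n ^ k n" "s n ^ k n \<le> 1" "(1 - s n) * s n ^ k n \<le> 1"
  using s_range by (auto intro: power_le_one intro!: mult_le_one)

lemma s_power:
  assumes "n \<ge> 1" "s n = exp (- (ln (real n) + w) / real (k n))"
  shows "s n ^ k n = exp (- w) / real n"
proof -
  have "s n ^ k n = exp (- (ln (real n) + w))"
    using k_pos[of n] assms by (simp flip: exp_of_nat_mult)
  also have "\<dots> = exp (- w) / exp (ln (real n))"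
    by (simp flip: exp_diff)
  finally show ?thesis using assms by simp
qed

lemma k_over_n: "(\<lambda>n. real (k n) / real n) \<longlonglongrightarrow> 0"
proof -
  have "(\<lambda>n. real (k n) / ln (real n) * (ln (real n) / real n)) \<longlonglongrightarrow> 0 * 0"
    by (intro tendsto_mult k_small) real_asymp
  moreover have "\<forall>\<^sub>F n in sequentially.
      real (k n) / ln (real n) * (ln (real n) / real n) = real (k n) / real n"
    using eventually_gt_at_top[of 1] by eventually_elim auto
  ultimately show ?thesis using Lim_transform_eventually by fastforce
qed

text \<open>Bernoulli's inequality turns the bound on \<open>R n\<close> into the union bound \<open>n s^k = exp (- \<omega>)\<close>.\<close>

lemma subcritical:
  assumes \<omega>: "filterlim \<omega> at_top sequentially"
    and s: "\<forall>\<^sub>F n in sequentially. s n = exp (- (ln (real n) + \<omega> n) / real (k n))"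
  shows "R \<longlonglongrightarrow> 0"
proof (rule tendsto_sandwich[of "\<lambda>_. 0" R sequentially "\<lambda>n. exp (- \<omega> n)"])
  show "\<forall>\<^sub>F n in sequentially. R n \<le> exp (- \<omega> n)"
    using s eventually_ge_at_top[of 1]
  proof eventually_elim
    case (elim n)
    have "1 + real n * (- (s n ^ k n)) \<le> (1 + - (s n ^ k n)) ^ n"
      using s_power_range by (intro Bernoulli_inequality) auto
    then have "R n \<le> real n * s n ^ k n" using R_le[of n] elim by simp
    also have "\<dots> = exp (- \<omega> n)" using s_power[of n "\<omega> n"] elim by simp
    finally show ?case .
  qed
  show "(\<lambda>n. exp (- \<omega> n)) \<longlonglongrightarrow> 0"
    using \<omega> by (intro filterlim_compose[OF exp_at_bot] filterlim_compose[OF filterlim_uminus_at_bot_at_top])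
qed (use R_range in auto)

text \<open>
  Here \<open>s^k = exp \<alpha> / n\<close>. The upper bound on \<open>R\<close> converges by the exponential limit; the lower bound
  has the extra factors \<open>1 - s\<close> and \<open>1 - k / n\<close> in the exponent, both of which tend to \<open>1\<close>.
\<close>

lemma critical:
  assumes s: "\<forall>\<^sub>F n in sequentially. s n = exp (- (ln (real n) - \<alpha>) / real (k n))"
  shows "R \<longlonglongrightarrow> 1 - exp (- exp \<alpha>)"
proof (rule tendsto_sandwich[of "\<lambda>n. 1 - exp (- ((1 - s n) * exp \<alpha> * (1 - real (k n) / real n)))" R])
  show "\<forall>\<^sub>F n in sequentially. R n \<le> 1 - (1 + (- exp \<alpha>) / real n) ^ n"
    using s eventually_ge_at_top[of 1]
  proof eventually_elim
    case (elim n)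
    then show ?case using R_le[of n] s_power[of n "- \<alpha>"] by simp
  qed
  show "(\<lambda>n. 1 - (1 + (- exp \<alpha>) / real n) ^ n) \<longlonglongrightarrow> 1 - exp (- exp \<alpha>)"
    by (intro tendsto_intros tendsto_exp_limit_sequentially)
  show "\<forall>\<^sub>F n in sequentially. 1 - exp (- ((1 - s n) * exp \<alpha> * (1 - real (k n) / real n))) \<le> R n"
    using s eventually_ge_at_top[of 1]
  proof eventually_elim
    case (elim n)
    have sk: "s n ^ k n = exp \<alpha> / real n" using s_power[of n "- \<alpha>"] elim by simp
    have "(1 - (1 - s n) * s n ^ k n) ^ (n - k n) \<le> exp (- ((1 - s n) * s n ^ k n) * real (n - k n))"
      by (rule one_minus_power_le_exp) (rule s_power_range)
    also have "\<dots> \<le> exp (- ((1 - s n) * s n ^ k n) * (real n - real (k n)))"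
      using s_range s_power_range by (simp add: mult_left_mono)
    also have "- ((1 - s n) * s n ^ k n) * (real n - real (k n)) =
        - ((1 - s n) * exp \<alpha> * (1 - real (k n) / real n))"
      unfolding sk using elim(2) by (simp add: field_simps)
    finally show ?case using R_ge[of n] elim by simp
  qed
  have "s \<longlonglongrightarrow> 0"
  proof -
    have "\<forall>\<^sub>F n in sequentially. real (k n) / ln (real n) > 0"
      using eventually_gt_at_top[of 1] by eventually_elim (use k_pos in auto)
    then have "filterlim (\<lambda>n. inverse (real (k n) / ln (real n))) at_top sequentially"
      by (intro filterlim_inverse_at_top k_small)
    then have 1: "filterlim (\<lambda>n. ln (real n) / real (k n)) at_top sequentially" by simp
    have 2: "(\<lambda>n. \<alpha> / real (k n)) \<longlonglongrightarrow> 0"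
      by (intro tendsto_divide_0[OF tendsto_const] filterlim_at_top_imp_at_infinity
          filterlim_compose[OF filterlim_real_sequentially k_large])
    have "filterlim (\<lambda>n. - (\<alpha> / real (k n)) + ln (real n) / real (k n)) at_top sequentially"
      by (rule filterlim_tendsto_add_at_top[OF tendsto_minus[OF 2] 1])
    then have "(\<lambda>n. exp (- (- (\<alpha> / real (k n)) + ln (real n) / real (k n)))) \<longlonglongrightarrow> 0"
      by (intro filterlim_compose[OF exp_at_bot] filterlim_compose[OF filterlim_uminus_at_bot_at_top])
    moreover have "\<forall>\<^sub>F n in sequentially.
        exp (- (- (\<alpha> / real (k n)) + ln (real n) / real (k n))) = s n"
      using s by eventually_elim (simp add: diff_divide_distrib)
    ultimately show ?thesis by (rule Lim_transform_eventually)
  qed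
  then have "(\<lambda>n. 1 - exp (- ((1 - s n) * exp \<alpha> * (1 - real (k n) / real n))))
      \<longlonglongrightarrow> 1 - exp (- ((1 - 0) * exp \<alpha> * (1 - 0)))"
    by (intro tendsto_intros k_over_n)
  then show "(\<lambda>n. 1 - exp (- ((1 - s n) * exp \<alpha> * (1 - real (k n) / real n))))
      \<longlonglongrightarrow> 1 - exp (- exp \<alpha>)" by simp
qed

text \<open>
  No limit of \<open>s\<close> is available here, since \<open>\<omega>\<close> may be nearly as large as \<open>ln n\<close>. The case distinction at
  \<open>s = 1/2\<close> is made separately for every \<open>n\<close>, and the sum of the two resulting error terms serves both cases.
\<close>

lemma supercritical:
  assumes \<omega>: "filterlim \<omega> at_top sequentially"
    and s: "\<forall>\<^sub>F n in sequentially. s n = exp (- (ln (real n) - \<omega> n) / real (k n))"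
  shows "R \<longlonglongrightarrow> 1"
proof (rule tendsto_sandwich)
  let ?E = "\<lambda>n. exp (- (exp (\<omega> n) / 4)) + exp (1 - exp (ln (real n) / 2))"
  have k_lt_ln: "\<forall>\<^sub>F n in sequentially. real (k n) / ln (real n) < 1 / 4"
    using k_small by (rule order_tendstoD) simp
  have k_lt_n: "\<forall>\<^sub>F n in sequentially. real (k n) / real n < 1 / 2"
    using k_over_n by (rule order_tendstoD) simp
  show "\<forall>\<^sub>F n in sequentially. 1 - ?E n \<le> R n"
    using s k_lt_ln k_lt_n eventually_gt_at_top[of 1]
  proof eventually_elim
    case (elim n)
    have n: "real n > 1" "ln (real n) > 0" using elim by auto
    have kn: "0 < real (k n)" "real (k n) < ln (real n) / 4" "real (k n) < real n / 2"
      using elim n k_pos[of n] by (auto simp: field_simps)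
    show ?case
    proof (cases "s n \<le> 1 / 2")
      case True
      have sk: "s n ^ k n = exp (\<omega> n) / real n" using s_power[of n "- \<omega> n"] elim by simp
      have "exp (\<omega> n) / 4 = (1 / 2) * s n ^ k n * (real n / 2)" using n by (simp add: sk)
      also have "\<dots> \<le> (1 - s n) * s n ^ k n * real (n - k n)"
        using True kn s_power_range by (intro mult_mono) auto
      finally have "exp (- ((1 - s n) * s n ^ k n) * real (n - k n)) \<le> exp (- (exp (\<omega> n) / 4))"
        by simp
      then have "(1 - (1 - s n) * s n ^ k n) ^ (n - k n) \<le> exp (- (exp (\<omega> n) / 4))"
        using one_minus_power_le_exp[OF s_power_range(3), of n "n - k n"] by (rule order_trans[rotated])
      moreover have "0 < exp (1 - exp (ln (real n) / 2))" by simp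
      ultimately show ?thesis using R_ge[of n] elim by linarith
    next
      case False
      \<comment> \<open>Since \<open>1/e < 1/2 < s\<close> and \<open>k \<le> exp k\<close>, the exponent \<open>s^k n / k\<close> is at least \<open>n exp (- 2 k)\<close>,
        which exceeds \<open>sqrt n\<close> as \<open>k < ln n / 4\<close>; rounding \<open>n / k\<close> down costs at most \<open>1\<close>.\<close>
      have "exp (- real (k n)) = exp (- 1) ^ k n" by (simp flip: exp_of_nat_mult)
      also have "\<dots> \<le> s n ^ k n"
      proof (rule power_mono)
        have "2 \<le> exp (1 :: real)" using exp_ge_add_one_self[of 1] by simp
        then have "exp (- 1 :: real) \<le> 1 / 2" by (simp add: exp_minus field_simps)
        then show "exp (- 1) \<le> s n" using False by linarith
      qed simp
      finally have sk: "exp (- real (k n)) \<le> s n ^ k n" .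
      have k_exp: "real (k n) \<le> exp (real (k n))"
        using exp_ge_add_one_self[of "real (k n)"] by linarith
      have "exp (ln (real n) / 2) = exp (- (ln (real n) / 2)) * exp (ln (real n))"
        by (simp flip: exp_add)
      also have "\<dots> \<le> exp (- 2 * real (k n)) * real n"
        using kn n by (intro mult_mono) auto
      also have "\<dots> = exp (- real (k n)) * (real n / exp (real (k n)))"
        by (simp add: exp_minus field_simps flip: exp_add)
      also have "\<dots> \<le> s n ^ k n * (real n / real (k n))"
        using sk k_exp kn n s_power_range by (intro mult_mono divide_left_mono) auto
      also have "\<dots> \<le> s n ^ k n * (real (n div k n) + 1)"
      proof (rule mult_left_mono)
        have "n \<le> (n div k n + 1) * k n"
          using dividend_less_div_times[of "k n" n] kn by (simp add: add.commute)
        then have "real n \<le> (real (n div k n) + 1) * real (k n)"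
          by (metis of_nat_1 of_nat_add of_nat_le_iff of_nat_mult)
        then show "real n / real (k n) \<le> real (n div k n) + 1"
          using kn by (simp add: divide_le_eq)
      qed (rule s_power_range)
      also have "\<dots> \<le> s n ^ k n * real (n div k n) + 1"
        using s_power_range[of n] by (simp add: algebra_simps)
      finally have "exp (- (s n ^ k n) * real (n div k n)) \<le> exp (1 - exp (ln (real n) / 2))"
        by simp
      then have "(1 - s n ^ k n) ^ (n div k n) \<le> exp (1 - exp (ln (real n) / 2))"
        using one_minus_power_le_exp[OF s_power_range(2), of n "n div k n"] by (rule order_trans[rotated])
      moreover have "0 < exp (- (exp (\<omega> n) / 4))" by simp
      ultimately show ?thesis using R_ge_blocks[of n] elim by linarith
    qed
  qed
  have "(\<lambda>n. exp (- (exp (\<omega> n) / 4))) \<longlonglongrightarrow> 0"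
    by (rule filterlim_compose[OF _ \<omega>]) real_asymp
  moreover have "(\<lambda>n. exp (1 - exp (ln (real n) / 2))) \<longlonglongrightarrow> 0" by real_asymp
  ultimately have "(\<lambda>n. 1 - ?E n) \<longlonglongrightarrow> 1 - (0 + 0)" by (intro tendsto_intros)
  then show "(\<lambda>n. 1 - ?E n) \<longlonglongrightarrow> 1" by simp
qed (use R_range in auto)

end

section \<open>Components and gaps of geometric compositions\<close>

text \<open>Components and gaps are the cases \<open>x \<noteq> 0\<close> and \<open>x = 0\<close> of \<open>Q x\<close>, with \<open>comp_max\<close> and \<open>gap_max\<close>
  as \<open>longest\<close>.\<close>

lemma run_probability_sequence_geometric_composition:
  fixes k :: "nat \<Rightarrow> nat" and p :: "nat \<Rightarrow> real" and longest :: "nat \<Rightarrow> (nat \<Rightarrow> nat) \<Rightarrow> nat"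
  assumes k: "\<forall>n\<ge>1. 0 < k n" "filterlim k at_top sequentially"
      "(\<lambda>n. real (k n) / ln (real n)) \<longlonglongrightarrow> 0"
    and longest: "\<And>n C. longest n C = Max (insert 0 (card ` {S. maximal_run n (\<lambda>i. Q (C i)) S}))"
  shows "run_probability_sequence k (\<lambda>n. measure_pmf.prob (geometric_pmf (1 - p n)) {x. Q x})
    (\<lambda>n. measure_pmf.prob (geometric_composition n (p n)) {C. longest n C \<ge> k n})"
proof -
  let ?s = "\<lambda>n. measure_pmf.prob (geometric_pmf (1 - p n)) {x. Q x}"
  let ?R = "\<lambda>n. measure_pmf.prob (geometric_composition n (p n)) {C. longest n C \<ge> k n}"
  have bounds: "?R n \<le> 1 - (1 - ?s n ^ k n) ^ n"
    "1 - (1 - (1 - ?s n) * ?s n ^ k n) ^ (n - k n) \<le> ?R n"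
    "1 - (1 - ?s n ^ k n) ^ (n div k n) \<le> ?R n" if n: "n \<ge> 1" for n
  proof -
    interpret iid_trials "0 :: nat" "geometric_pmf (1 - p n)" Q "k n"
      by unfold_locales (use k n in simp)
    have "?R n = 1 - no_run_prob n"
      unfolding prob_has_run[symmetric] has_run_def geometric_composition_def longest
        longest_run_ge_iff[OF k_pos] ..
    then show "?R n \<le> 1 - (1 - ?s n ^ k n) ^ n"
      "1 - (1 - (1 - ?s n) * ?s n ^ k n) ^ (n - k n) \<le> ?R n"
      "1 - (1 - ?s n ^ k n) ^ (n div k n) \<le> ?R n"
      using no_run_prob_lower_bound[of n] no_run_prob_upper_bound[of n] no_run_prob_upper_bound_blocks[of n]
      unfolding success_prob_def by simp_all
  qed
  show ?thesis
    by unfold_locales (use k bounds in auto)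
qed

theorem proposition3p4:
  fixes k :: "nat \<Rightarrow> nat" and \<omega> :: "nat \<Rightarrow> real" and \<alpha> :: real and p :: "nat \<Rightarrow> real"
  assumes k_pos: "\<forall>n\<ge>1. 0 < k n"
    and k_large: "filterlim k at_top sequentially"
    and k_small: "(\<lambda>n. real (k n) / ln (real n)) \<longlonglongrightarrow> 0"
    and omega_large: "filterlim \<omega> at_top sequentially"
    and p_range: "\<forall>n. 0 \<le> p n \<and> p n < 1"
  shows
    "((\<forall>\<^sub>F n in sequentially. p n = exp (- (ln (real n) + \<omega> n) / real (k n))) \<longrightarrow>
        (\<lambda>n. measure_pmf.prob (geometric_composition n (p n)) {C. comp_max n C \<ge> k n})
          \<longlonglongrightarrow> 0) \<and>
     ((\<forall>\<^sub>F n in sequentially. p n = exp (- (ln (real n) - \<alpha>) / real (k n))) \<longrightarrow>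
        (\<lambda>n. measure_pmf.prob (geometric_composition n (p n)) {C. comp_max n C \<ge> k n})
          \<longlonglongrightarrow> 1 - exp (- exp \<alpha>)) \<and>
     ((\<forall>\<^sub>F n in sequentially. p n = exp (- (ln (real n) - \<omega> n) / real (k n))) \<longrightarrow>
        (\<lambda>n. measure_pmf.prob (geometric_composition n (p n)) {C. comp_max n C \<ge> k n})
          \<longlonglongrightarrow> 1) \<and>
     ((\<forall>\<^sub>F n in sequentially. 1 - p n = exp (- (ln (real n) - \<omega> n) / real (k n))) \<longrightarrow>
        (\<lambda>n. measure_pmf.prob (geometric_composition n (p n)) {C. gap_max n C \<ge> k n})
          \<longlonglongrightarrow> 1) \<and>
     ((\<forall>\<^sub>F n in sequentially. 1 - p n = exp (- (ln (real n) - \<alpha>) / real (k n))) \<longrightarrow>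
        (\<lambda>n. measure_pmf.prob (geometric_composition n (p n)) {C. gap_max n C \<ge> k n})
          \<longlonglongrightarrow> 1 - exp (- exp \<alpha>)) \<and>
     ((\<forall>\<^sub>F n in sequentially. 1 - p n = exp (- (ln (real n) + \<omega> n) / real (k n))) \<longrightarrow>
        (\<lambda>n. measure_pmf.prob (geometric_composition n (p n)) {C. gap_max n C \<ge> k n})
          \<longlonglongrightarrow> 0)"
proof -
  have zero: "measure_pmf.prob (geometric_pmf (1 - p n)) {x. x = 0} = 1 - p n" for n
    using p_range[rule_format, of n] by (simp add: measure_pmf_single)
  have nonzero: "measure_pmf.prob (geometric_pmf (1 - p n)) {x. x \<noteq> 0} = p n" for n
  proof -
    have "{x :: nat. x \<noteq> 0} = space (measure_pmf (geometric_pmf (1 - p n))) - {x. x = 0}" by auto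
    then show ?thesis using zero[of n]
      by (simp only: measure_pmf.prob_compl sets_measure_pmf UNIV_I)
  qed
  interpret comp: run_probability_sequence k p
    "\<lambda>n. measure_pmf.prob (geometric_composition n (p n)) {C. comp_max n C \<ge> k n}"
    using run_probability_sequence_geometric_composition[OF k_pos k_large k_small,
        of comp_max "\<lambda>x. x \<noteq> 0" p]
    unfolding nonzero by (simp add: comp_max_def components_def)
  interpret gap: run_probability_sequence k "\<lambda>n. 1 - p n"
    "\<lambda>n. measure_pmf.prob (geometric_composition n (p n)) {C. gap_max n C \<ge> k n}"
    using run_probability_sequence_geometric_composition[OF k_pos k_large k_small,
        of gap_max "\<lambda>x. x = 0" p]
    unfolding zero by (simp add: gap_max_def gaps_def)
  show ?thesis
    by (intro conjI impI comp.subcritical[OF omega_large] comp.critical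
        comp.supercritical[OF omega_large] gap.subcritical[OF omega_large] gap.critical
        gap.supercritical[OF omega_large])
qed

end
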